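(* Let $\alpha,\beta,c,d>0$ and $l\ge 0$ be real constants with $l<\alpha<\frac{\beta(l+1)+l}{\beta+2}$. Then there exists a solution $u>0$ on $\mathbb{R}^+$ of $$\big(|u'|^{l}u'\big)'+c|u'|^{\alpha}u'+d|u|^{\beta}u=0$$ such that for some constant $C>0$ $$\forall t\ge 0,\quad u(t)\le C(1+t)^{-\frac{1-\alpha+l}{\alpha-l}},\qquad |u'(t)|\le C(1+t)^{-\frac{1}{\alpha-l}}.$$
   Context: $\mathbb{R}^+=[0,+\infty)$. A solution on $\mathbb{R}^+$ is a function $u\in\mathcal{C}^1(\mathbb{R}^+)$ with $|u'|^lu'\in\mathcal{C}^1(\mathbb{R}^+)$ which satisfies the equation at every point. *)

theory Defs
  imports "HOL-Analysis.Analysis"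
begin

text \<open>Derivatives on \<open>[0,\<infinity>)\<close> are taken relative to that set, so they are one-sided at 0 and
  the values of the function at negative arguments are irrelevant.\<close>

definition C1_nonneg :: "(real \<Rightarrow> real) \<Rightarrow> bool" where
  "C1_nonneg f \<longleftrightarrow>
     (\<exists>f'. (\<forall>t\<ge>0. (f has_real_derivative f' t) (at t within {0..})) \<and> continuous_on {0..} f')"

definition deriv_nonneg :: "(real \<Rightarrow> real) \<Rightarrow> real \<Rightarrow> real" where
  "deriv_nonneg f t = vector_derivative f (at t within {0..})"

text \<open>\<open>signed_pow p x\<close> is \<open>|x|\<^sup>p x\<close>. The library convention \<open>0 powr 0 = 0\<close> is harmless here:
  \<open>signed_pow 0 x = x\<close> for every \<open>x\<close>.\<close>

definition signed_pow :: "real \<Rightarrow> real \<Rightarrow> real" where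
  "signed_pow p x = \<bar>x\<bar> powr p * x"

definition is_solution :: "real \<Rightarrow> real \<Rightarrow> real \<Rightarrow> real \<Rightarrow> real \<Rightarrow> (real \<Rightarrow> real) \<Rightarrow> bool" where
  "is_solution l \<alpha> \<beta> c d u \<longleftrightarrow>
     C1_nonneg u \<and>
     C1_nonneg (\<lambda>t. signed_pow l (deriv_nonneg u t)) \<and>
     (\<forall>t\<ge>0. deriv_nonneg (\<lambda>s. signed_pow l (deriv_nonneg u s)) t
              + c * signed_pow \<alpha> (deriv_nonneg u t) + d * signed_pow \<beta> (u t) = 0)"

end

theory Submission
  imports Defs
begin

text \<open>Put \<open>\<gamma> = 1 / (1 + l - \<alpha>)\<close> and \<open>m = \<gamma> - 1 > 0\<close>. For a positive decreasing solution, regard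
  \<open>z = \<bar>u'\<bar> powr (1 / \<gamma>)\<close> as a function of \<open>u\<close>. With \<open>p = \<gamma> (\<alpha> + 1)\<close> and suitable constants
  \<open>k, h > 0\<close> the equation becomes \<open>dz/du = k - h u\<^sup>\<beta>\<^sup>+\<^sup>1 z\<^sup>-\<^sup>p\<close>, and the slow solutions are those with
  \<open>z \<sim> k u\<close> at \<open>0\<close>. Writing \<open>z = u y(u)\<close>, this is \<open>(u y)' = k - h u\<^sup>q y\<^sup>-\<^sup>p\<close> with
  \<open>q = \<beta> + 1 - p\<close>; the upper bound on \<open>\<alpha>\<close> says exactly that \<open>q > 0\<close>, so the integrated equation
  is a contraction for small \<open>u\<close>. Finally \<open>u' = - z\<^sup>\<gamma>\<close> turns into \<open>s' = m y(u)\<^sup>\<gamma>\<close> for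
  \<open>s = u\<^sup>-\<^sup>m\<close>. The right-hand side is bounded between positive constants, so \<open>s\<close> grows linearly,
  which gives the decay rates.\<close>

section \<open>Auxiliary first-order equations and a Lipschitz bound\<close>

text \<open>Integrating from 0 and rescaling to the unit interval removes the singularity:
  \<open>y x\<close> equals \<open>k\<close> minus the integral of
  \<open>\<phi> (x * r) * \<psi> (y (x * r))\<close> over \<open>r\<close> in \<open>{0..1}\<close>.
  Since \<phi> is small near 0, the right-hand side is a contraction in \<open>y\<close>.\<close>

lemma singular_ode_at_zero:
  fixes \<phi> \<psi> :: "real \<Rightarrow> real" and k L M \<epsilon> :: real
  assumes cont_\<phi>: "continuous_on UNIV \<phi>" and \<phi>0: "\<phi> 0 = 0"
    and lip: "L-lipschitz_on UNIV \<psi>" and bnd: "\<And>v. \<bar>\<psi> v\<bar> \<le> M" and "\<epsilon> > 0"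
  obtains \<delta> y where "\<delta> > 0" "continuous_on UNIV y" "\<And>x. \<bar>y x - k\<bar> \<le> \<epsilon>"
    "\<And>x. \<lbrakk>0 < x; x < \<delta>\<rbrakk> \<Longrightarrow>
       ((\<lambda>x. x * y x) has_real_derivative k - \<phi> x * \<psi> (y x)) (at x)"
proof -
  have L: "L \<ge> 0" using lip by (rule lipschitz_on_nonneg)
  have M: "M \<ge> 0" using bnd[of 0] by linarith
  have cont_\<psi>: "continuous_on UNIV \<psi>" using lip by (rule lipschitz_on_continuous_on)
  \<comment> \<open>\<open>\<eta>\<close> will bound \<phi> on \<open>[0, \<delta>]\<close>: the
    first entry gives contraction factor 1/2, the second keeps the image within \<epsilon> of
    \<open>k\<close>. Adding 1 guards against \<open>L = 0\<close> or \<open>M = 0\<close>.\<close>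
  define \<eta> where "\<eta> = min (1 / (2 * (L + 1))) (\<epsilon> / (M + 1))"
  have \<eta>: "\<eta> > 0" using L M \<open>\<epsilon> > 0\<close> by (simp add: \<eta>_def)
  have "\<eta> * (L + 1) \<le> 1 / (2 * (L + 1)) * (L + 1)"
    using L by (intro mult_right_mono) (auto simp: \<eta>_def)
  also have "\<dots> = 1 / 2" using L by (simp add: field_simps)
  finally have \<eta>L: "\<eta> * L \<le> 1 / 2" using \<eta> by (simp add: algebra_simps)
  have "\<eta> * (M + 1) \<le> \<epsilon> / (M + 1) * (M + 1)"
    using M by (intro mult_right_mono) (auto simp: \<eta>_def)
  also have "\<dots> = \<epsilon>" using M by simp
  finally have \<eta>M: "\<eta> * M \<le> \<epsilon>" using \<eta> by (simp add: algebra_simps)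
  have "isCont \<phi> 0" using cont_\<phi> continuous_on_eq_continuous_at by blast
  then obtain \<delta>' where \<delta>': "\<delta>' > 0" "\<And>x. \<bar>x\<bar> < \<delta>' \<Longrightarrow> \<bar>\<phi> x\<bar> < \<eta>"
    using \<eta> \<phi>0 by (auto simp: continuous_at_eps_delta dist_real_def)
  define \<delta> where "\<delta> = \<delta>' / 2"
  have \<delta>: "\<delta> > 0" using \<delta>' by (simp add: \<delta>_def)
  \<comment> \<open>Truncating at \<open>0\<close> and \<open>\<delta>\<close> lets the operator act on bounded continuous functions on the whole line.\<close>
  define cl where "cl x = max 0 (min x \<delta>)" for x
  have \<phi>_small: "\<bar>\<phi> (cl x * r)\<bar> \<le> \<eta>" if "r \<in> {0..1}" for x r
  proof -
    have "0 \<le> cl x" "cl x \<le> \<delta>" using \<delta> by (auto simp: cl_def)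
    then have "cl x * r \<le> \<delta> * 1" "0 \<le> cl x * r" using that by (intro mult_mono, auto)
    then show ?thesis using \<delta>'(2)[of "cl x * r"] \<delta> by (simp add: \<delta>_def)
  qed
  define g where "g y x r = \<phi> (cl x * r) * \<psi> (apply_bcontfun y (cl x * r))"
    for y :: "real \<Rightarrow>\<^sub>C real" and x r
  have cont_comp: "continuous_on S (\<lambda>z. \<phi> (f z))" "continuous_on S (\<lambda>z. \<psi> (f z))"
    "continuous_on S (\<lambda>z. apply_bcontfun y (f z))"
    if "continuous_on S f" for S :: "'b::topological_space set" and f and y :: "real \<Rightarrow>\<^sub>C real"
    using that continuous_on_compose2[OF cont_\<phi>] continuous_on_compose2[OF cont_\<psi>]
      continuous_on_compose2[OF continuous_on_apply_bcontfun[of UNIV]] by auto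
  have cont_g: "continuous_on S (\<lambda>(x, r). g y x r)" for S y
    unfolding g_def cl_def case_prod_unfold by (intro continuous_intros cont_comp)
  have cont_g1: "continuous_on S (g y x)" for S y x
    unfolding g_def by (intro continuous_intros cont_comp)
  have g_bound: "\<bar>g y x r\<bar> \<le> \<epsilon>" if "r \<in> {0..1}" for y x r
  proof -
    have "\<bar>g y x r\<bar> \<le> \<eta> * M"
      unfolding g_def abs_mult using \<phi>_small[OF that] bnd \<eta> by (intro mult_mono) auto
    then show ?thesis using \<eta>M by linarith
  qed
  define T where "T y x = k - integral {0..1} (g y x)" for y x
  have T_bound: "\<bar>T y x - k\<bar> \<le> \<epsilon>" for y x
    using integral_bound[OF _ cont_g1, of 0 1 y x \<epsilon>] g_bound by (simp add: T_def)
  have cont_T: "continuous_on UNIV (T y)" for y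
    unfolding T_def using integral_continuous_on_param[OF cont_g, of UNIV 0 1 y]
    by (auto intro!: continuous_intros)
  have "T y \<in> bcontfun" for y
  proof (rule bcontfun_normI[OF cont_T])
    show "norm (T y x) \<le> \<bar>k\<bar> + \<epsilon>" for x using T_bound[of y x] by simp
  qed
  then have app_T: "apply_bcontfun (Bcontfun (T y)) = T y" for y
    by (rule Bcontfun_inverse)
  have "dist (Bcontfun (T y)) (Bcontfun (T z)) \<le> 1 / 2 * dist y z" for y z
  proof (rule dist_bound)
    fix x
    have "norm (integral {0..1} (\<lambda>r. g y x r - g z x r)) \<le> 1 / 2 * dist y z * (1 - 0)"
    proof (rule integral_bound)
      show "continuous_on {0..1} (\<lambda>r. g y x r - g z x r)"
        by (intro continuous_intros cont_g1)
      fix r :: real assume r: "r \<in> {0..1}"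
      let ?s = "cl x * r"
      have "\<bar>\<psi> (y ?s) - \<psi> (z ?s)\<bar> \<le> L * dist (y ?s) (z ?s)"
        using lipschitz_onD[OF lip, of "y ?s" "z ?s"] by (simp add: dist_real_def)
      also have "\<dots> \<le> L * dist y z" using L by (intro mult_left_mono dist_bounded)
      finally have "\<bar>\<phi> ?s\<bar> * \<bar>\<psi> (y ?s) - \<psi> (z ?s)\<bar> \<le> \<eta> * (L * dist y z)"
        using \<phi>_small[OF r] \<eta> by (intro mult_mono) auto
      also have "\<dots> \<le> 1 / 2 * dist y z"
        using mult_right_mono[OF \<eta>L, of "dist y z"] by (simp add: mult.assoc)
      finally show "norm (g y x r - g z x r) \<le> 1 / 2 * dist y z"
        by (simp add: g_def abs_mult flip: right_diff_distrib)
    qed simp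
    moreover have "integral {0..1} (\<lambda>r. g y x r - g z x r)
        = integral {0..1} (g y x) - integral {0..1} (g z x)"
      by (intro integral_diff integrable_continuous_interval cont_g1)
    ultimately show "dist (Bcontfun (T y) x) (Bcontfun (T z) x) \<le> 1 / 2 * dist y z"
      unfolding app_T by (simp add: T_def dist_real_def abs_minus_commute)
  qed
  then have "\<exists>!y. Bcontfun (T y) = y" by (intro banach_fix_type[of "1/2"]) auto
  then obtain y where "Bcontfun (T y) = y" by blast
  then have y: "apply_bcontfun y x = T y x" for x using app_T[of y] by metis
  let ?f = "\<lambda>s. \<phi> s * \<psi> (y s)"
  have cont_f: "continuous_on S ?f" for S by (intro continuous_intros cont_comp)
  \<comment> \<open>For \<open>0 < x < \<delta>\<close> the truncation \<open>cl\<close> is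
    inactive, so the substitution \<open>s = x * r\<close> undoes the rescaling.\<close>
  have xy: "x * y x = k * x - integral {0..x} ?f" if "0 < x" "x < \<delta>" for x
  proof -
    have "(?f has_integral integral {0..x} ?f) {0..x}"
      by (intro integrable_integral integrable_continuous_interval cont_f)
    from has_integral_stretch_real[OF this, of x] that
    have "((\<lambda>r. ?f (x * r)) has_integral integral {0..x} ?f / x) {0..1}"
      by (simp add: field_simps)
    moreover have "g y x = (\<lambda>r. ?f (x * r))" using that by (simp add: fun_eq_iff g_def cl_def)
    ultimately have "integral {0..1} (g y x) = integral {0..x} ?f / x"
      by (simp add: integral_unique)
    then show ?thesis using that unfolding y T_def by (simp add: right_diff_distrib)
  qed
  show ?thesis
  proof (rule that[OF \<delta>])
    show "continuous_on UNIV (apply_bcontfun y)" by simp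
    show "\<bar>y x - k\<bar> \<le> \<epsilon>" for x using T_bound[of y x] y[of x] by simp
    fix x assume x: "0 < x" "x < \<delta>"
    have "((\<lambda>x. integral {0..x} ?f) has_real_derivative ?f x) (at x within {0..\<delta>})"
      using x by (intro integral_has_real_derivative cont_f) auto
    then have "((\<lambda>x. integral {0..x} ?f) has_real_derivative ?f x) (at x)"
      using x by (simp add: at_within_Icc_at)
    then have "((\<lambda>x. k * x - integral {0..x} ?f) has_real_derivative k - ?f x) (at x)"
      by (auto intro!: derivative_eq_intros)
    then show "((\<lambda>x. x * y x) has_real_derivative k - ?f x) (at x)"
    proof (rule DERIV_cong_ev[THEN iffD1, rotated -1])
      show "\<forall>\<^sub>F x in nhds x. k * x - integral {0..x} ?f = x * y x"
        using eventually_nhds_in_open[of "{0<..<\<delta>}" x] x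
        by (auto elim!: eventually_mono simp: xy)
    qed auto
  qed
qed

text \<open>Separation of variables: time as a function of the state is an antiderivative
  \<open>G\<close> of \<open>1 / F\<close>. It increases with slope at least \<open>1 / B\<close>,
  hence maps onto the whole line, and its inverse is a global solution.\<close>

lemma autonomous_ode_exists:
  fixes F :: "real \<Rightarrow> real" and B s0 :: real
  assumes cont: "continuous_on UNIV F" and pos: "\<And>x. F x > 0" and upper: "\<And>x. F x \<le> B"
  obtains s where "s 0 = s0" "\<And>t. (s has_real_derivative F (s t)) (at t)"
proof -
  have B: "B > 0" using pos[of 0] upper[of 0] by linarith
  have "\<exists>G. \<forall>x::real. (-\<infinity>::ereal) < x \<longrightarrow> x < (\<infinity>::ereal) \<longrightarrow>
      (G has_vector_derivative inverse (F x)) (at x)"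
    using cont pos less_imp_neq[OF pos]
    by (intro einterval_antiderivative)
       (auto simp: continuous_on_eq_continuous_at intro!: continuous_intros)
  then obtain G0 where G0: "\<And>x. (G0 has_real_derivative inverse (F x)) (at x)"
    by (auto simp: has_real_derivative_iff_has_vector_derivative)
  define G where "G x = G0 x - G0 s0" for x
  have G: "(G has_real_derivative inverse (F x)) (at x)" for x
    unfolding G_def using G0 by (auto intro!: derivative_eq_intros)
  have mono: "strict_mono G"
  proof (rule strict_monoI)
    fix x y :: real assume "x < y"
    then show "G x < G y"
      by (rule DERIV_pos_imp_increasing) (meson G pos positive_imp_inverse_positive)
  qed
  have grow: "(y - x) / B \<le> G y - G x" if "x \<le> y" for x y
  proof -
    have "G x - x / B \<le> G y - y / B"
    proof (rule DERIV_nonneg_imp_nondecreasing[OF that])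
      fix z
      have "inverse B \<le> inverse (F z)" using pos upper by (simp add: le_imp_inverse_le)
      then show "\<exists>D. ((\<lambda>x. G x - x / B) has_real_derivative D) (at z) \<and> 0 \<le> D"
        using B by (intro exI[of _ "inverse (F z) - 1 / B"])
          (auto intro!: derivative_eq_intros G simp: field_simps)
    qed
    then show ?thesis by (simp add: diff_divide_distrib)
  qed
  have contG: "isCont G x" for x using G DERIV_isCont by blast
  have "\<exists>x. G x = t" for t
  proof -
    \<comment> \<open>With slope at least \<open>1 / B\<close>, moving a distance
      \<open>B * \<bar>t\<bar>\<close> from \<open>s0\<close> changes \<open>G\<close> by at least
      \<open>\<bar>t\<bar>\<close>.\<close>
    define r where "r = B * \<bar>t\<bar>"
    have r: "r \<ge> 0" "r / B = \<bar>t\<bar>" using B by (auto simp: r_def)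
    have "G (s0 - r) \<le> t" "t \<le> G (s0 + r)"
      using grow[of s0 "s0 + r"] grow[of "s0 - r" s0] r by (auto simp: G_def)
    then show ?thesis
      using IVT[of G "s0 - r" t "s0 + r"] contG r by auto
  qed
  then obtain s where s: "\<And>t. G (s t) = t" by metis
  have sG: "s (G x) = x" for x using s strict_mono_eq[OF mono] by blast
  have "s 0 = s0" using sG[of s0] by (simp add: G_def)
  moreover have "(s has_real_derivative F (s t)) (at t)" for t
  proof -
    have "isCont s (G (s t))"
      by (rule isCont_inverse_function[of 1]) (auto simp: sG contG)
    then have "isCont s t" by (simp add: s)
    then have "(s has_real_derivative inverse (inverse (F (s t)))) (at t)"
      using pos[of "s t"] s
      by (intro DERIV_inverse_function[where f = G and a = "t - 1" and b = "t + 1"] G) auto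
    then show ?thesis by simp
  qed
  ultimately show ?thesis using that by blast
qed

text \<open>The cutoff at \<open>b\<close> removes the singularity of the negative power at 0;
  beyond it the derivative is largest in modulus at \<open>b\<close>. This makes the power
  \<open>y\<^sup>-\<^sup>p\<close> admissible as \<psi> in
  \<open>singular_ode_at_zero\<close>.\<close>

lemma lipschitz_powr_max:
  fixes a b :: real
  assumes "b > 0" "a > 0"
  shows "(a * b powr (- a - 1))-lipschitz_on UNIV (\<lambda>v. max v b powr (- a))"
proof (rule lipschitz_onI)
  fix v w :: real
  have "norm (max v b powr (- a) - max w b powr (- a))
      \<le> a * b powr (- a - 1) * norm (max v b - max w b)"
  proof (rule field_differentiable_bound[where S = "{b..}" and f' = "\<lambda>x. - a * x powr (- a - 1)"])
    fix x assume x: "x \<in> {b..}"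
    then show "((\<lambda>x. x powr (- a)) has_field_derivative - a * x powr (- a - 1)) (at x within {b..})"
      using \<open>b > 0\<close>
      by (intro has_field_derivative_at_within[OF has_real_derivative_powr]) auto
    have "x powr (- a - 1) \<le> b powr (- a - 1)"
      using x assms by (intro powr_mono2') auto
    then show "norm (- a * x powr (- a - 1)) \<le> a * b powr (- a - 1)"
      using \<open>a > 0\<close> by (simp add: abs_mult)
  qed auto
  also have "\<dots> \<le> a * b powr (- a - 1) * \<bar>v - w\<bar>"
    using assms by (intro mult_left_mono) auto
  finally show "dist (max v b powr (- a)) (max w b powr (- a)) \<le> a * b powr (- a - 1) * dist v w"
    by (simp add: dist_real_def)
qed (use assms in auto)

section \<open>One-sided derivatives and solutions on the half-line\<close>

lemma deriv_nonneg_eqI: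
  assumes "t \<ge> 0" and "(f has_real_derivative D) (at t within {0..})"
  shows "deriv_nonneg f t = D"
proof -
  have "t islimpt {t..t + 1}" by (simp add: islimpt_Icc)
  then have "t islimpt {0..}" by (rule islimpt_subset) (use \<open>t \<ge> 0\<close> in auto)
  then have "at t within {0..} \<noteq> bot" by (simp add: trivial_limit_within)
  then show ?thesis
    using assms(2) unfolding deriv_nonneg_def
    by (auto intro!: vector_derivative_within simp: has_real_derivative_iff_has_vector_derivative)
qed

lemma is_solutionI:
  fixes u v w :: "real \<Rightarrow> real"
  assumes u: "\<And>t. t \<ge> 0 \<Longrightarrow> (u has_real_derivative v t) (at t)"
    and v: "\<And>t. t \<ge> 0 \<Longrightarrow> ((\<lambda>t. signed_pow l (v t)) has_real_derivative w t) (at t)"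
    and cont: "continuous_on {0..} v" "continuous_on {0..} w"
    and eq: "\<And>t. t \<ge> 0 \<Longrightarrow> w t + c * signed_pow \<alpha> (v t) + d * signed_pow \<beta> (u t) = 0"
  shows "is_solution l \<alpha> \<beta> c d u"
proof -
  have u': "(u has_real_derivative v t) (at t within {0..})" if "t \<ge> 0" for t
    using u[OF that] by (rule has_field_derivative_at_within)
  have du: "deriv_nonneg u t = v t" if "t \<ge> 0" for t
    using that u' by (intro deriv_nonneg_eqI)
  \<comment> \<open>\<open>deriv_nonneg u\<close> and \<open>v\<close> are known to agree only on
    \<open>{0..}\<close>, which is enough for a derivative relative to that set.\<close>
  have w': "((\<lambda>t. signed_pow l (deriv_nonneg u t)) has_real_derivative w t) (at t within {0..})"
    if "t \<ge> 0" for t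
    by (rule has_field_derivative_transform_within[OF has_field_derivative_at_within[OF v[OF that]], of 1])
       (use that du in auto)
  show "is_solution l \<alpha> \<beta> c d u"
    unfolding is_solution_def C1_nonneg_def
    using u' w' cont du deriv_nonneg_eqI[OF _ w'] eq by auto
qed

theorem theorem5p4:
  fixes \<alpha> \<beta> c d l :: real
  assumes "\<alpha> > 0" and "\<beta> > 0" and "c > 0" and "d > 0" and "l \<ge> 0"
    and "l < \<alpha>" and "\<alpha> < (\<beta> * (l + 1) + l) / (\<beta> + 2)"
  shows "\<exists>u :: real \<Rightarrow> real. is_solution l \<alpha> \<beta> c d u \<and> (\<forall>t\<ge>0. u t > 0) \<and>
           (\<exists>C>0. \<forall>t\<ge>0. u t \<le> C * (1 + t) powr (- ((1 - \<alpha> + l) / (\<alpha> - l))) \<and>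
                          \<bar>deriv_nonneg u t\<bar> \<le> C * (1 + t) powr (- (1 / (\<alpha> - l))))"
proof -

  \<comment> \<open>Exponents and constants\<close>
  \<comment> \<open>The upper bound on \<alpha> is used twice: here it also forces
    \<open>\<alpha> < l + 1\<close>, so that \<gamma> is positive.\<close>
  have gap: "\<alpha> * (\<beta> + 2) < \<beta> * (l + 1) + l"
    using assms(2,7) by (simp add: pos_less_divide_eq)
  also have "\<dots> < (1 + l) * (\<beta> + 2)" using assms by (simp add: algebra_simps)
  finally have \<alpha>: "1 + l - \<alpha> > 0" using \<open>\<beta> > 0\<close> by simp
  define \<gamma> where "\<gamma> = 1 / (1 + l - \<alpha>)"
  define m where "m = \<gamma> - 1"
  define N where "N = \<gamma> * (l + 1)"
  define p where "p = \<gamma> * (\<alpha> + 1)"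
  define q where "q = \<beta> + 1 - p"
  define k where "k = c / N"
  define h where "h = d / N"
  have "\<gamma> > 1" using \<alpha> \<open>l < \<alpha>\<close> by (simp add: \<gamma>_def)
  have m: "m > 0" using \<open>\<gamma> > 1\<close> by (simp add: m_def)
  have N: "N > 0" using \<open>\<gamma> > 1\<close> assms by (simp add: N_def)
  have p: "p > 0" using \<open>\<gamma> > 1\<close> assms by (simp add: p_def)
  have q: "q > 0" using \<alpha> gap by (simp add: q_def p_def \<gamma>_def field_simps)
  have k: "k > 0" using N assms by (simp add: k_def)
  have h: "h > 0" using N assms by (simp add: h_def)
  \<comment> \<open>This identity dictates the choice of \<gamma>: the leading term carries
    \<open>z\<close> to the power \<open>N - 1 + \<gamma>\<close> and the damping term carries it to
    the power \<open>p\<close>, so after division the damping becomes the constant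
    \<open>k\<close>.\<close>
  have p_eq: "N - 1 + \<gamma> = p" using \<alpha> by (simp add: N_def p_def \<gamma>_def field_simps)
  have exp1: "(1 - \<alpha> + l) / (\<alpha> - l) = 1 / m" and exp2: "1 / (\<alpha> - l) = \<gamma> / m"
    using \<alpha> \<open>l < \<alpha>\<close> by (simp_all add: m_def \<gamma>_def field_simps)

  \<comment> \<open>The profile \<open>z = u y(u)\<close> and the equation for
    \<open>s\<close>\<close>
  have cont_\<phi>: "continuous_on UNIV (\<lambda>x. h * max x 0 powr q)"
    using q by (intro continuous_intros continuous_on_powr') auto
  have \<phi>0: "h * max 0 0 powr q = 0" by simp
  have bnd: "\<bar>max v (k / 2) powr (- p)\<bar> \<le> (k / 2) powr (- p)" for v
    using k p by (auto intro!: powr_mono2')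
  have lip: "(p * (k / 2) powr (- p - 1))-lipschitz_on UNIV (\<lambda>v. max v (k / 2) powr (- p))"
    using k p by (intro lipschitz_powr_max) auto
  \<comment> \<open>Taking \<open>k / 2\<close> both as radius \<epsilon> and as cutoff level
    confines \<open>y\<close> to \<open>[k / 2, 3 * k / 2]\<close>, where the cutoff is
    inactive.\<close>
  have "k / 2 > 0" using k by simp
  from singular_ode_at_zero[OF cont_\<phi> \<phi>0 lip bnd this, of k]
  obtain \<delta> y where \<delta>: "\<delta> > 0" and cont_y: "continuous_on UNIV y"
    and y_k: "\<And>x. \<bar>y x - k\<bar> \<le> k / 2"
    and y': "\<And>x. \<lbrakk>0 < x; x < \<delta>\<rbrakk> \<Longrightarrow> ((\<lambda>x. x * y x) has_real_derivative
              k - h * max x 0 powr q * max (y x) (k / 2) powr (- p)) (at x)"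
    by blast
  have y_lb: "k / 2 \<le> y x" and y_ub: "y x \<le> 3 * k / 2" for x
    using y_k[of x] by linarith+
  have y_pos: "y x > 0" for x using y_lb[of x] k by linarith
  have z': "((\<lambda>x. x * y x) has_real_derivative
      k - h * x powr (\<beta> + 1) * (x * y x) powr (- p)) (at x)" if "0 < x" "x < \<delta>" for x
  proof -
    have "x powr (\<beta> + 1) * (x * y x) powr (- p) = x powr q * y x powr (- p)"
      using that y_pos[of x] by (simp add: powr_mult q_def powr_diff powr_minus field_simps)
    moreover have "max (y x) (k / 2) = y x" using y_lb[of x] by simp
    ultimately show ?thesis using y'[OF that] that by (simp add: mult.assoc)
  qed

  \<comment> \<open>The \<open>max\<close> only serves to make \<open>F\<close> continuous on the whole line; \<open>s \<ge> 1\<close> along the solution.\<close>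
  define F where "F s = m * y (max s 1 powr (- (1 / m))) powr \<gamma>" for s
  define A where "A = m * (k / 2) powr \<gamma>"
  have A: "A > 0" using m k by (simp add: A_def)
  have F_lb: "A \<le> F s" for s
    unfolding A_def F_def using m k y_lb \<open>\<gamma> > 1\<close> by (intro mult_left_mono powr_mono2) auto
  have F_ub: "F s \<le> m * (3 * k / 2) powr \<gamma>" for s
    unfolding F_def using m k y_ub y_pos \<open>\<gamma> > 1\<close>
    by (intro mult_left_mono powr_mono2) (auto intro: less_imp_le)
  have "continuous_on UNIV F"
    unfolding F_def using y_pos
    by (intro continuous_intros continuous_on_compose2[OF cont_y]) (auto simp: less_imp_neq[symmetric])
  moreover have "F s > 0" for s using F_lb[of s] A by linarith
  \<comment> \<open>The term \<open>\<delta> powr (- m)\<close> starts \<open>u\<close> inside the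
    interval where the profile solves its equation; the extra 1 makes that strict and ensures
    \<open>s \<ge> 1\<close>. Both persist because \<open>s\<close> increases.\<close>
  ultimately obtain s where s0: "s 0 = \<delta> powr (- m) + 1"
    and s': "\<And>t. (s has_real_derivative F (s t)) (at t)"
    using autonomous_ode_exists F_ub by metis
  have s_lb: "\<delta> powr (- m) + 1 + A * t \<le> s t" if "t \<ge> 0" for t
  proof -
    have "s 0 - A * 0 \<le> s t - A * t"
      by (rule DERIV_nonneg_imp_nondecreasing[OF that])
         (use F_lb in \<open>auto intro!: derivative_eq_intros s' exI[of _ "F (s _) - A"]\<close>)
    then show ?thesis using s0 by simp
  qed
  have s_gt: "\<delta> powr (- m) < s t" and s_ge1: "1 \<le> s t" if "t \<ge> 0" for t
  proof -
    have "0 \<le> A * t" using A that by simp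
    then show "\<delta> powr (- m) < s t" "1 \<le> s t"
      using s_lb[OF that] powr_ge_zero[of \<delta> "- m"] by linarith+
  qed

  \<comment> \<open>Return from \<open>s\<close> to \<open>u\<close> and verification of the
    equation\<close>
  define u where "u t = s t powr (- (1 / m))" for t
  define Z where "Z t = u t * y (u t)" for t
  have u_pos: "u t > 0" if "t \<ge> 0" for t using s_ge1[OF that] by (simp add: u_def)
  have u_less: "u t < \<delta>" if "t \<ge> 0" for t
  proof -
    have "u t < (\<delta> powr (- m)) powr (- (1 / m))"
      unfolding u_def using s_gt[OF that] m \<delta> by (intro powr_less_mono2_neg) auto
    then show ?thesis using m \<delta> by (simp add: powr_powr)
  qed
  have Z_pos: "Z t > 0" if "t \<ge> 0" for t using u_pos[OF that] y_pos by (simp add: Z_def)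
  have u': "(u has_real_derivative - (Z t powr \<gamma>)) (at t)" if t: "t \<ge> 0" for t
  proof -
    have "F (s t) = m * y (u t) powr \<gamma>" using s_ge1[OF t] by (simp add: F_def u_def max_def)
    \<comment> \<open>Since \<open>\<gamma> = m + 1\<close>, the exponent on the left is
      \<open>- \<gamma> / m\<close>.\<close>
    moreover have "s t powr (- (1 / m) - 1) = u t powr \<gamma>"
      using m by (simp add: u_def powr_powr m_def field_simps)
    moreover have "(u has_real_derivative
        - (1 / m) * s t powr (- (1 / m) - 1) * F (s t)) (at t)"
      unfolding u_def using s_ge1[OF t] s'
      by (auto intro!: derivative_eq_intros)
    ultimately show ?thesis
      using m u_pos[OF t] y_pos[of "u t"] by (simp add: Z_def powr_mult)
  qed
  have Z': "(Z has_real_derivative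
      (k - h * u t powr (\<beta> + 1) * Z t powr (- p)) * - (Z t powr \<gamma>)) (at t)" if t: "t \<ge> 0" for t
    unfolding Z_def using DERIV_chain2[OF z'[OF u_pos[OF t] u_less[OF t]] u'[OF t]]
    by (simp add: Z_def)
  define v where "v t = - (Z t powr \<gamma>)" for t
  define w where "w t = c * Z t powr p - d * u t powr (\<beta> + 1)" for t
  have sp: "signed_pow a (v t) = - (Z t powr (\<gamma> * (a + 1)))" for t a
    by (simp add: signed_pow_def v_def powr_powr powr_add algebra_simps)
  have v': "((\<lambda>t. signed_pow l (v t)) has_real_derivative w t) (at t)" if t: "t \<ge> 0" for t
  proof -
    have "((\<lambda>t. - (Z t powr N)) has_real_derivative
        - (N * Z t powr (N - 1) * ((k - h * u t powr (\<beta> + 1) * Z t powr (- p)) * - (Z t powr \<gamma>)))) (at t)"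
      using Z_pos[OF t] by (auto intro!: derivative_eq_intros Z'[OF t])
    also have "- (N * Z t powr (N - 1) * ((k - h * u t powr (\<beta> + 1) * Z t powr (- p)) * - (Z t powr \<gamma>)))
      = N * (k - h * u t powr (\<beta> + 1) * Z t powr (- p)) * (Z t powr (N - 1) * Z t powr \<gamma>)"
      by (simp add: algebra_simps)
    also have "Z t powr (N - 1) * Z t powr \<gamma> = Z t powr p"
      by (simp add: p_eq flip: powr_add)
    also have "N * (k - h * u t powr (\<beta> + 1) * Z t powr (- p)) * Z t powr p = w t"
      using N Z_pos[OF t] by (simp add: w_def k_def h_def powr_minus field_simps)
    finally show ?thesis by (simp add: sp N_def)
  qed
  have cont: "continuous_on {0..} u" "continuous_on {0..} Z"
    using u' Z' by (meson DERIV_isCont atLeast_iff continuous_at_imp_continuous_on)+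
  have cont_v: "continuous_on {0..} v"
    unfolding v_def using Z_pos by (intro continuous_intros cont) (auto simp: less_imp_neq[symmetric])
  have cont_w: "continuous_on {0..} w"
    unfolding w_def using Z_pos u_pos
    by (intro continuous_intros cont) (auto simp: less_imp_neq[symmetric])
  have eq: "w t + c * signed_pow \<alpha> (v t) + d * signed_pow \<beta> (u t) = 0" if "t \<ge> 0" for t
    using u_pos[OF that] sp[of \<alpha> t]
    by (simp add: w_def p_def signed_pow_def powr_add)
  have sol: "is_solution l \<alpha> \<beta> c d u"
    using u'[folded v_def] v' cont_v cont_w eq by (rule is_solutionI)
  have deriv_u: "deriv_nonneg u t = v t" if "t \<ge> 0" for t
    unfolding v_def
    by (rule deriv_nonneg_eqI[OF that has_field_derivative_at_within[OF u'[OF that]]])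

  \<comment> \<open>Decay rates\<close>
  \<comment> \<open>With this minimum, \<open>1 + A * t\<close> is at least
    \<open>c0 * (1 + t)\<close>, which turns the linear growth of \<open>s\<close> into a power of
    \<open>1 + t\<close>.\<close>
  define c0 where "c0 = min 1 A"
  have c0: "c0 > 0" using A by (simp add: c0_def)
  define C where "C = c0 powr (- (1 / m))"
  have u_ub: "u t \<le> C * (1 + t) powr (- (1 / m))" if t: "t \<ge> 0" for t
  proof -
    have "c0 * (1 + t) \<le> 1 + A * t"
      using t mult_right_mono[of c0 A t] by (simp add: c0_def algebra_simps)
    also have "\<dots> \<le> s t" using s_lb[OF t] powr_ge_zero[of \<delta> "- m"] by linarith
    finally have "u t \<le> (c0 * (1 + t)) powr (- (1 / m))"
      unfolding u_def using m c0 t by (intro powr_mono2') auto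
    then show ?thesis using c0 t by (simp add: C_def powr_mult)
  qed
  have v_ub: "\<bar>v t\<bar> \<le> (C * (3 * k / 2)) powr \<gamma> * (1 + t) powr (- (\<gamma> / m))" if t: "t \<ge> 0" for t
  proof -
    \<comment> \<open>As \<open>\<bar>u'\<bar> = Z\<^sup>\<gamma>\<close> and \<open>Z\<close> is at
      most \<open>3 * k / 2\<close> times \<open>u\<close>, the bound on \<open>u\<close> raised to
      the power \<gamma> gives the rate of the derivative.\<close>
    have "Z t \<le> (C * (1 + t) powr (- (1 / m))) * (3 * k / 2)"
      unfolding Z_def using u_ub[OF t] y_ub[of "u t"] y_pos[of "u t"] by (intro mult_mono) (auto simp: C_def)
    then have "Z t powr \<gamma> \<le> ((C * (1 + t) powr (- (1 / m))) * (3 * k / 2)) powr \<gamma>"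
      using Z_pos[OF t] \<open>\<gamma> > 1\<close> by (intro powr_mono2) auto
    also have "(C * (1 + t) powr (- (1 / m))) * (3 * k / 2) = (C * (3 * k / 2)) * (1 + t) powr (- (1 / m))"
      by simp
    also have "\<dots> powr \<gamma> = (C * (3 * k / 2)) powr \<gamma> * (1 + t) powr (- (\<gamma> / m))"
      using k by (subst powr_mult) (auto simp: C_def powr_powr)
    finally show ?thesis by (simp add: v_def)
  qed
  let ?C = "max C ((C * (3 * k / 2)) powr \<gamma>)"
  have "?C > 0" using c0 by (simp add: C_def less_max_iff_disj)
  moreover have "u t \<le> ?C * (1 + t) powr (- ((1 - \<alpha> + l) / (\<alpha> - l)))" if "t \<ge> 0" for t
    unfolding exp1 by (rule order_trans[OF u_ub[OF that]]) (auto intro: mult_right_mono)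
  moreover have "\<bar>deriv_nonneg u t\<bar> \<le> ?C * (1 + t) powr (- (1 / (\<alpha> - l)))" if "t \<ge> 0" for t
    unfolding exp2 deriv_u[OF that]
    by (rule order_trans[OF v_ub[OF that]]) (auto intro: mult_right_mono)
  ultimately show ?thesis using sol u_pos by blast
qed

end
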